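(* Let $\alpha\in[1,2)$, let $A\in\mathbb{R}^{3\times 3}$ have characteristic polynomial $f(\lambda)=\lambda^3+a_1\lambda^2+a_2\lambda+a_3$, and put $s=\cos^2\left(\frac{\alpha\pi}{2}\right)$. Then the fractional-order system $\mathrm{D}^{\alpha}x=Ax$ is asymptotically stable if and only if the following three inequalities hold: $$a_1>0,$$ $$\left(4a_1a_3-4a_2^2\right)s+a_1^2a_2-a_1a_3>0,$$ $$-a_3\cdot\Big(64a_3^2s^3-\left(16a_1a_2a_3+48a_3^2\right)s^2+\left(4a_1^3a_3-4a_1a_2a_3+4a_2^3+12a_3^2\right)s-a_1^2a_2^2+2a_1a_2a_3-a_3^2\Big)>0.$$
   Context: The system is $\mathrm{D}^{\alpha}x=Ax$ with state vector $x$, fractional order $\alpha\in[1,2)$ and real matrix $A$. Asymptotic stability is used through the known criterion of Matignon: the system is asymptotically stable if and only if every eigenvalue $\lambda_j\in\mathbb{C}$ of $A$ satisfies $|\arg(\lambda_j)|>\frac{\alpha\pi}{2}$, where $\arg$ is the principal argument in $(-\pi,\pi]$ (a zero eigenvalue is regarded as violating this condition). *)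

theory Defs
  imports Complex_Main "Jordan_Normal_Form.Char_Poly"
begin

(* Asymptotic stability of the fractional-order system D^\<alpha> x = A x, for 1 \<le> \<alpha> < 2, in the form
   given by Matignon's criterion on the complex spectrum of the real matrix A.
   Arg is the principal argument in (-pi, pi]. Since Arg 0 = 0 and 0 \<le> \<alpha>, a zero eigenvalue
   already fails the angle condition; the conjunct z \<noteq> 0 makes this convention explicit. *)
definition fractional_asymptotically_stable :: "real \<Rightarrow> real mat \<Rightarrow> bool" where
  "fractional_asymptotically_stable \<alpha> A \<longleftrightarrow>
     (\<forall>z :: complex. eigenvalue (map_mat complex_of_real A) z \<longrightarrow>
        z \<noteq> 0 \<and> \<bar>Arg z\<bar> > \<alpha> * pi / 2)"

end

theory Submission
  imports Defs
begin

text \<open>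
  Write $f = (\lambda + x)(\lambda + y)(\lambda + z)$. The last inequality says $a_3 G > 0$, where $G$
  is the product of $(x+y)^2 - 4sxy$ and its two analogues; such a factor vanishes precisely when
  one root is the other one rotated by the angle $\pm\alpha\pi$. If all roots are real, the second
  form is $\sum xy((x+y)^2 - 4sxy) + 4a_1a_3(1-s)$. If $f = (\lambda+m)(\lambda^2+p\lambda+q)$ with
  $p^2 < 4q$, stability means $m, p > 0$ and $p^2 > 4sq$, $G$ is a nonnegative multiple of $p^2 - 4sq$, and
  the second form, being affine in $s$, is controlled by its values at $s = 0$ and at $s = p^2/(4q)$.
\<close>

text \<open>At \<open>s = 0\<close>, that is for \<alpha> = 1, this is
  \<open>a * (a * b - c)\<close>, so \<open>a\<close> times the Hurwitz determinant of the
  cubic.\<close>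

definition rotation_form :: "real \<Rightarrow> real \<Rightarrow> real \<Rightarrow> real \<Rightarrow> real" where
  "rotation_form s a b c = (4 * a * c - 4 * b ^ 2) * s + a ^ 2 * b - a * c"

text \<open>With \<omega> = exp(i \<alpha> pi), the resultant of f(\<lambda>) and f(\<omega>
  \<lambda>) is \<open>c\<close> times this form, up to a nonzero constant depending on
  \<omega>.\<close>

definition rotation_resultant :: "real \<Rightarrow> real \<Rightarrow> real \<Rightarrow> real \<Rightarrow> real" where
  "rotation_resultant s a b c =
     - (64 * c ^ 2 * s ^ 3 - (16 * a * b * c + 48 * c ^ 2) * s ^ 2
        + (4 * a ^ 3 * c - 4 * a * b * c + 4 * b ^ 3 + 12 * c ^ 2) * s
        - a ^ 2 * b ^ 2 + 2 * a * b * c - c ^ 2)"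

definition rotation_conditions :: "real \<Rightarrow> real \<Rightarrow> real \<Rightarrow> real \<Rightarrow> bool" where
  "rotation_conditions s a b c \<longleftrightarrow>
     a > 0 \<and> rotation_form s a b c > 0 \<and> c * rotation_resultant s a b c > 0"

section \<open>Three real roots\<close>

lemma rotation_resultant_roots:
  "rotation_resultant s (x + y + z) (x*y + y*z + z*x) (x*y*z) =
     ((x+y)^2 - 4*s*x*y) * ((y+z)^2 - 4*s*y*z) * ((z+x)^2 - 4*s*z*x)"
  unfolding rotation_resultant_def by Groebner_Basis.algebra

lemma rotation_form_roots:
  "rotation_form s (x + y + z) (x*y + y*z + z*x) (x*y*z) =
     x*y*((x+y)^2 - 4*s*x*y) + y*z*((y+z)^2 - 4*s*y*z) + z*x*((z+x)^2 - 4*s*z*x)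
     + 4*(1-s)*((x+y+z)*(x*y*z))"
  unfolding rotation_form_def by Groebner_Basis.algebra

text \<open>A convex combination of (x-y)^2 and (x+y)^2, hence nonnegative whatever the signs of
  \<open>x\<close> and \<open>y\<close>.\<close>

lemma rotation_factor_nonneg:
  fixes s x y :: real
  assumes "0 \<le> s" "s \<le> 1"
  shows "0 \<le> (x+y)^2 - 4*s*x*y"
proof -
  have "(x+y)^2 - 4*s*x*y = s * (x-y)^2 + (1-s) * (x+y)^2" by Groebner_Basis.algebra
  then show ?thesis using assms by simp
qed

lemma rotation_factor_pos:
  fixes s x y :: real
  assumes "s < 1" "0 < x" "0 < y"
  shows "0 < (x+y)^2 - 4*s*x*y"
proof -
  have "(x+y)^2 - 4*s*x*y = (x-y)^2 + 4*((1-s)*(x*y))" by Groebner_Basis.algebra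
  moreover have "0 < (1-s)*(x*y)" using assms by simp
  ultimately show ?thesis by (metis add_nonneg_pos mult_pos_pos zero_le_power2 zero_less_numeral)
qed

text \<open>At \<open>s = 0\<close> the form is (x+y+z)(x+y)(y+z)(z+x), where x+y > -z > 0 and z+x >
  -y > 0 but y+z < 0. Its slope in \<open>s\<close> is nonpositive, so it stays negative.\<close>

lemma rotation_form_two_negative:
  fixes s x y z :: real
  assumes "0 \<le> s" and "y < 0" "z < 0" and sum: "0 < x + y + z"
  shows "rotation_form s (x + y + z) (x*y + y*z + z*x) (x*y*z) < 0"
proof -
  have "0 < x * y * z" using assms by (simp add: mult_neg_neg mult.assoc)
  then have "0 < (x+y+z) * (x*y*z)" using sum by simp
  moreover have "(x*y + y*z + z*x)^2 - (x+y+z)*(x*y*z)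
      = (x*y)^2 + (y*z)^2 + (z*x)^2 + (x+y+z)*(x*y*z)" by Groebner_Basis.algebra
  ultimately have "0 \<le> (x*y + y*z + z*x)^2 - (x+y+z)*(x*y*z)"
    using zero_le_power2[of "x*y"] zero_le_power2[of "y*z"] zero_le_power2[of "z*x"] by linarith
  then have 1: "0 \<le> 4 * s * ((x*y + y*z + z*x)^2 - (x+y+z)*(x*y*z))" using \<open>0 \<le> s\<close> by simp
  have "(x+y) * (y+z) * (z+x) < 0"
    using assms by (simp add: mult_pos_neg mult_neg_pos mult_pos_neg)
  then have 2: "(x+y+z) * ((x+y) * (y+z) * (z+x)) < 0" using sum by (rule mult_pos_neg[rotated])
  have "rotation_form s (x + y + z) (x*y + y*z + z*x) (x*y*z) =
      (x+y+z) * ((x+y) * (y+z) * (z+x)) - 4 * s * ((x*y + y*z + z*x)^2 - (x+y+z)*(x*y*z))"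
    unfolding rotation_form_def by Groebner_Basis.algebra
  then show ?thesis using 1 2 by linarith
qed

lemma rotation_conditions_real_roots:
  fixes s x y z :: real
  assumes s: "0 \<le> s" "s < 1"
  shows "rotation_conditions s (x + y + z) (x*y + y*z + z*x) (x*y*z) \<longleftrightarrow> 0 < x \<and> 0 < y \<and> 0 < z"
proof
  assume pos: "0 < x \<and> 0 < y \<and> 0 < z"
  have f: "0 < (x+y)^2 - 4*s*x*y" "0 < (y+z)^2 - 4*s*y*z" "0 < (z+x)^2 - 4*s*z*x"
    using s pos by (simp_all only: rotation_factor_pos)
  have "0 < x*y*((x+y)^2 - 4*s*x*y)" "0 < y*z*((y+z)^2 - 4*s*y*z)" "0 < z*x*((z+x)^2 - 4*s*z*x)"
    "0 < 4*(1-s)*((x+y+z)*(x*y*z))"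
    using f pos s by (simp_all only: mult_pos_pos add_pos_pos zero_less_numeral diff_gt_0_iff_gt)
  moreover have "0 < x*y*z * (((x+y)^2 - 4*s*x*y) * ((y+z)^2 - 4*s*y*z) * ((z+x)^2 - 4*s*z*x))"
    using f pos by (simp only: mult_pos_pos)
  ultimately show "rotation_conditions s (x + y + z) (x*y + y*z + z*x) (x*y*z)"
    using pos unfolding rotation_conditions_def rotation_form_roots rotation_resultant_roots
    by (auto simp only: intro: add_pos_pos)
next
  assume cond: "rotation_conditions s (x + y + z) (x*y + y*z + z*x) (x*y*z)"
  then have sum: "0 < x + y + z"
    and form: "0 < rotation_form s (x + y + z) (x*y + y*z + z*x) (x*y*z)"
    and res: "0 < x*y*z * rotation_resultant s (x + y + z) (x*y + y*z + z*x) (x*y*z)"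
    unfolding rotation_conditions_def by auto
  have "0 \<le> rotation_resultant s (x + y + z) (x*y + y*z + z*x) (x*y*z)"
    unfolding rotation_resultant_roots
    using s by (intro mult_nonneg_nonneg rotation_factor_nonneg) auto
  with res have xyz: "0 < x*y*z" by (smt (verit) mult_nonpos_nonneg)
  \<comment> \<open>A positive product leaves no negative factor or exactly two. The form is
    symmetric, so one lemma excludes all three pairs.\<close>
  have "\<not> (y < 0 \<and> z < 0)" using rotation_form_two_negative[of s y z x] s sum form by auto
  moreover have "\<not> (z < 0 \<and> x < 0)"
    using rotation_form_two_negative[of s z x y] s sum form by (auto simp: ac_simps)
  moreover have "\<not> (x < 0 \<and> y < 0)"
    using rotation_form_two_negative[of s x y z] s sum form by (auto simp: ac_simps)
  ultimately show "0 < x \<and> 0 < y \<and> 0 < z"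
    using xyz by (auto simp: zero_less_mult_iff mult_less_0_iff)
qed

section \<open>A pair of non-real roots\<close>

text \<open>For a conjugate pair u, cnj u with sum \<open>p\<close> and product \<open>q\<close>,
  the two factors mixing \<open>m\<close> with the pair are conjugate. Their product is |(m+u)^2 -
  4smu|^2, expanded here by u^2 = pu - q into squared real and imaginary parts.\<close>

lemma rotation_resultant_quadratic:
  "rotation_resultant s (m + p) (q + m * p) (m * q) =
     (p^2 - 4*s*q) * ((m^2 - q + (p + (2 - 4*s) * m) * p / 2)^2 + (q - p^2/4) * (p + (2 - 4*s) * m)^2)"
  unfolding rotation_resultant_def by (simp add: field_simps power2_eq_square power3_eq_cube)

lemma rotation_conditions_complex_roots:
  fixes s m p q :: real
  assumes s: "0 \<le> s" "s < 1" and disc: "p^2 < 4 * q"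
  shows "rotation_conditions s (m + p) (q + m * p) (m * q) \<longleftrightarrow> 0 < m \<and> 0 < p \<and> 4 * s * q < p^2"
proof -
  have q: "0 < q" using disc zero_le_power2[of p] by linarith
  \<comment> \<open>The form \<open>K\<close> is affine in \<open>s\<close>: its value at
    \<open>s = 0\<close> is \<open>(m + p) * p * C\<close>, and at the critical s = p^2/(4q) it is
    \<open>p * m * B / q\<close>. Completing squares gives the signs of \<open>B\<close> and
    \<open>C\<close>.\<close>
  define B where "B = q^2 + q * m^2 + p * m * (3*q - p^2)"
  define C where "C = m^2 + q + m * p"
  define W where "W = (m^2 - q + (p + (2 - 4*s) * m) * p / 2)^2 + (q - p^2/4) * (p + (2 - 4*s) * m)^2"
  define K where "K = rotation_form s (m + p) (q + m * p) (m * q)"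
  have "4 * q * B = (2*q*m + p*(3*q - p^2))^2 + (4*q - p^2) * (p^2 - q)^2"
    unfolding B_def by Groebner_Basis.algebra
  then have "0 \<le> 4 * q * B" using disc by simp
  then have B: "0 \<le> B" using q by (simp add: zero_le_mult_iff)
  have "4 * C = (2*m + p)^2 + (4*q - p^2)" unfolding C_def by Groebner_Basis.algebra
  then have C: "0 < C" using disc zero_le_power2[of "2*m + p"] by linarith
  have W: "0 \<le> W" using disc unfolding W_def by simp
  have res: "rotation_resultant s (m + p) (q + m * p) (m * q) = (p^2 - 4*s*q) * W"
    unfolding W_def by (rule rotation_resultant_quadratic)
  \<comment> \<open>\<open>K_convex\<close> interpolates between these two values;
    \<open>K_slope\<close> expands around the critical one.\<close>
  have K_convex: "p^2 * K = (p^2 - 4*s*q) * ((m + p) * p * C) + 4 * s * (p * m * B)"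
    unfolding K_def rotation_form_def B_def C_def by Groebner_Basis.algebra
  have K_slope: "q * K = p * m * B + (4*s*q - p^2) * ((m+p) * (m*q) - (q + m*p)^2)"
    unfolding K_def rotation_form_def B_def by Groebner_Basis.algebra
  have cond: "rotation_conditions s (m + p) (q + m * p) (m * q) \<longleftrightarrow>
      0 < m + p \<and> 0 < K \<and> 0 < m * q * ((p^2 - 4*s*q) * W)"
    unfolding rotation_conditions_def K_def res ..
  show ?thesis
  proof
    assume stable: "0 < m \<and> 0 < p \<and> 4 * s * q < p^2"
    \<comment> \<open>\<open>W = 0\<close> would make the pair equal to \<open>m\<close> rotated by
      \<alpha> pi in both directions: q = m^2 and p = (4s-2)m. With \<open>p > 0\<close> this gives
      s > 1/2 and then p^2 < 4sq.\<close>
    have "W \<noteq> 0"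
    proof
      assume "W = 0"
      moreover have "0 < q - p^2/4" using disc by simp
      ultimately have t: "p + (2 - 4*s) * m = 0"
        unfolding W_def by (smt (verit) mult_pos_pos zero_le_power2 zero_less_power2)
      with \<open>W = 0\<close> have mq: "q = m^2" unfolding W_def by simp
      have "p = (4*s - 2) * m" using t by (simp add: algebra_simps)
      then have "0 < (4*s - 2) * m" using stable by metis
      then have "1/2 < s" using stable by (simp add: zero_less_mult_iff)
      have "p^2 - 4*s*q = 4 * ((4*s - 1) * (s - 1)) * m^2"
        unfolding mq \<open>p = (4*s - 2) * m\<close> by Groebner_Basis.algebra
      moreover have "(4*s - 1) * (s - 1) < 0" using \<open>1/2 < s\<close> s by (intro mult_pos_neg) auto
      ultimately show False using stable
        by (smt (verit) mult_nonpos_nonneg zero_le_power2)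
    qed
    with W have "0 < W" by simp
    have "0 < (p^2 - 4*s*q) * ((m + p) * p * C)" using stable C by simp
    moreover have "0 \<le> 4 * s * (p * m * B)" using stable s B by simp
    ultimately have "0 < p^2 * K" unfolding K_convex by linarith
    then have "0 < K" by (simp add: zero_less_mult_iff)
    then show "rotation_conditions s (m + p) (q + m * p) (m * q)"
      unfolding cond using stable q \<open>0 < W\<close> by simp
  next
    assume "rotation_conditions s (m + p) (q + m * p) (m * q)"
    then have sum: "0 < m + p" and K: "0 < K" and "0 < m * q * ((p^2 - 4*s*q) * W)"
      unfolding cond by auto
    then have sgn: "0 < m * (p^2 - 4*s*q)"
      using W q by (auto simp: zero_less_mult_iff mult_less_0_iff)
    \<comment> \<open>Otherwise \<open>p > 0\<close> and \<open>s\<close> lies beyond the critical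
      value, where \<open>K\<close> is already nonpositive and its slope is nonpositive as
      well.\<close>
    have "0 < m"
    proof (rule ccontr)
      assume "\<not> 0 < m"
      with sgn have m: "m < 0" and d: "p^2 - 4*s*q < 0" by (auto simp: zero_less_mult_iff)
      have "p * m * B \<le> 0" using m sum B by (simp add: mult_nonpos_nonneg mult_nonneg_nonpos)
      moreover have "(m+p) * (m*q) \<le> 0" using m sum q
        by (simp add: mult_nonpos_nonneg mult_nonneg_nonpos)
      then have "(m+p) * (m*q) - (q + m*p)^2 \<le> 0" using zero_le_power2[of "q + m*p"] by linarith
      then have "(4*s*q - p^2) * ((m+p) * (m*q) - (q + m*p)^2) \<le> 0"
        using d by (intro mult_nonneg_nonpos) auto
      ultimately have "q * K \<le> 0" unfolding K_slope by linarith
      then show False using K q by (simp add: mult_le_0_iff)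
    qed
    with sgn have d: "0 < p^2 - 4*s*q" by (simp add: zero_less_mult_iff)
    \<comment> \<open>Now \<open>s\<close> lies below the critical value. For
      \<open>p \<le> 0\<close> both interpolated values of \<open>K\<close> would be
      nonpositive.\<close>
    have "0 < p"
    proof (rule ccontr)
      assume "\<not> 0 < p"
      then have p: "p \<le> 0" by simp
      have "p \<noteq> 0" using d s q by (auto simp: mult_less_0_iff)
      have "(m + p) * p * C \<le> 0" using p sum C by (simp add: mult_nonpos_nonneg mult_nonneg_nonpos)
      then have "(p^2 - 4*s*q) * ((m + p) * p * C) \<le> 0" using d by (simp add: mult_nonneg_nonpos)
      moreover have "p * m * B \<le> 0" using p \<open>0 < m\<close> B by (simp add: mult_nonpos_nonneg)
      then have "4 * s * (p * m * B) \<le> 0" using s by (simp add: mult_nonneg_nonpos)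
      ultimately have "p^2 * K \<le> 0" unfolding K_convex by linarith
      then show False using K \<open>p \<noteq> 0\<close> by (simp add: mult_le_0_iff)
    qed
    then show "0 < m \<and> 0 < p \<and> 4 * s * q < p^2" using \<open>0 < m\<close> d by simp
  qed
qed

section \<open>The sector condition on the roots\<close>

text \<open>Cosine decreases on [0, pi] and Re z = |z| cos(Arg z). At \<open>z = 0\<close> the right
  side reads 0 < 0, matching the convention for a zero eigenvalue.\<close>

lemma Arg_gt_iff:
  assumes "0 \<le> \<theta>" "\<theta> \<le> pi"
  shows "z \<noteq> 0 \<and> \<theta> < \<bar>Arg z\<bar> \<longleftrightarrow> Re z < cos \<theta> * cmod z"
proof (cases "z = 0")
  case False
  have "\<bar>Arg z\<bar> \<le> pi" using Arg_bounded[of z] by auto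
  then have "\<theta> < \<bar>Arg z\<bar> \<longleftrightarrow> cos \<bar>Arg z\<bar> < cos \<theta>"
    using assms cos_mono_less_eq[of "\<bar>Arg z\<bar>" \<theta>] by auto
  also have "Re z = cmod z * cos (Arg z)"
    by (metis Arg_correct False Re_complex_of_real cis.sel(1) complex_sgn_def mult.commute
        norm_eq_zero nonzero_divide_eq_eq Re_divide_of_real sgn_div_norm sgn_eq)
  ultimately show ?thesis using False by (simp add: mult.commute)
qed auto

lemma real_root_in_sector_iff:
  fixes c x :: real
  assumes "-1 < c" "c \<le> 0"
  shows "- x < c * \<bar>x\<bar> \<longleftrightarrow> 0 < x"
proof (cases "0 \<le> x")
  case True
  have "- x < c * x \<longleftrightarrow> 0 < (1 + c) * x" unfolding distrib_right by linarith
  then show ?thesis using True assms by (simp add: zero_less_mult_iff)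
next
  case False
  then have "c * \<bar>x\<bar> \<le> 0" using assms by (intro mult_nonpos_nonneg) auto
  then show ?thesis using False by linarith
qed

text \<open>Since \<open>c \<le> 0\<close>, the bound -2c sqrt(q) on \<open>p\<close> is
  nonnegative, so squaring loses only the sign of \<open>p\<close>.\<close>

lemma complex_root_in_sector_iff:
  fixes c p q :: real
  assumes "c \<le> 0" "0 < q"
  shows "- p / 2 < c * sqrt q \<longleftrightarrow> 0 < p \<and> 4 * c\<^sup>2 * q < p\<^sup>2"
proof -
  have "- p / 2 < c * sqrt q \<longleftrightarrow> - 2 * c * sqrt q < p" by auto
  also have "\<dots> \<longleftrightarrow> 0 < p \<and> (- 2 * c * sqrt q)\<^sup>2 < p\<^sup>2"
    using assms by (smt (verit) mult_nonneg_nonneg power2_less_imp_less power_strict_mono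
        real_sqrt_ge_zero pos2)
  also have "(- 2 * c * sqrt q)\<^sup>2 = 4 * c\<^sup>2 * q" using assms by (simp add: power_mult_distrib)
  finally show ?thesis .
qed

lemma monic_cubic_has_real_root:
  fixes a b c :: real
  obtains m where "poly [:c, b, a, 1:] (- m) = 0"
proof -
  obtain u where u: "\<forall>x\<ge>u. 1 \<le> poly [:c, b, a, 1:] x"
    using poly_pinfty_gt_lc[of "[:c, b, a, 1:]"] by auto
  \<comment> \<open>This polynomial is -f(-x), so its growth at infinity shows that f is negative
    far to the left.\<close>
  obtain v where v: "\<forall>x\<ge>v. 1 \<le> poly [:- c, b, - a, 1:] x"
    using poly_pinfty_gt_lc[of "[:- c, b, - a, 1:]"] by auto
  define w where "w = max 1 (max u v)"
  have w: "u \<le> w" "v \<le> w" "0 < w" by (simp_all add: w_def)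
  have "0 < poly [:c, b, a, 1:] w" using u[rule_format, OF w(1)] by linarith
  moreover have "poly [:c, b, a, 1:] (- w) = - poly [:- c, b, - a, 1:] w" by (simp add: algebra_simps)
  then have "poly [:c, b, a, 1:] (- w) < 0" using v[rule_format, OF w(2)] by linarith
  ultimately obtain x where "poly [:c, b, a, 1:] x = 0"
    using poly_IVT_pos[of "- w" w "[:c, b, a, 1:]"] w(3) by auto
  then show thesis using that[of "- x"] by simp
qed

lemma cubic_roots_in_sector_iff:
  fixes a b c t :: real
  assumes t: "-1 < t" "t \<le> 0"
  shows "(\<forall>z. poly [:of_real c, of_real b, of_real a, 1:] z = 0 \<longrightarrow> Re z < t * cmod z) \<longleftrightarrow>
    rotation_conditions (t\<^sup>2) a b c"
proof -
  have s: "0 \<le> t\<^sup>2" "t\<^sup>2 < 1" using t by (auto simp: abs_square_less_1)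
  obtain m where m: "poly [:c, b, a, 1:] (- m) = 0" by (rule monic_cubic_has_real_root)
  \<comment> \<open>Synthetic division by \<lambda> + m; the vanishing remainder is
    \<open>c = m * q\<close>.\<close>
  define p where "p = a - m"
  define q where "q = b - m * p"
  have abc: "a = m + p" "b = q + m * p" "c = m * q"
    using m unfolding p_def q_def by (simp_all add: algebra_simps)
  have split: "poly [:of_real c, of_real b, of_real a, 1:] z = (z + of_real m) * (z\<^sup>2 + of_real p * z + of_real q)"
    for z :: complex
    unfolding abc by (simp add: algebra_simps power2_eq_square)
  show ?thesis
  proof (cases "p\<^sup>2 < 4 * q")
    case False
    define d where "d = sqrt (p\<^sup>2 - 4 * q)"
    define x where "x = (p + d) / 2"
    define y where "y = (p - d) / 2"
    have "d\<^sup>2 = p\<^sup>2 - 4 * q" using False unfolding d_def by simp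
    then have pq: "p = x + y" "q = x * y"
      unfolding x_def y_def by (simp_all add: field_simps power2_eq_square)
    have "(z + of_real m) * (z\<^sup>2 + of_real p * z + of_real q) =
        (z + of_real m) * ((z + of_real x) * (z + of_real y))" for z :: complex
      unfolding pq by (simp add: algebra_simps power2_eq_square)
    then have "poly [:of_real c, of_real b, of_real a, 1:] z = 0 \<longleftrightarrow>
        z = - of_real m \<or> z = - of_real x \<or> z = - of_real y" for z :: complex
      unfolding split by (simp only: eq_neg_iff_add_eq_0 mult_eq_0_iff)
    then have "(\<forall>z. poly [:of_real c, of_real b, of_real a, 1:] z = 0 \<longrightarrow> Re z < t * cmod z) \<longleftrightarrow>
        0 < m \<and> 0 < x \<and> 0 < y"
      using t by (auto simp: real_root_in_sector_iff)
    also have "\<dots> \<longleftrightarrow> rotation_conditions (t\<^sup>2) (m + x + y) (m*x + x*y + y*m) (m*x*y)"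
      using rotation_conditions_real_roots[OF s] by simp
    also have "m + x + y = a" unfolding abc pq by simp
    also have "m*x + x*y + y*m = b" unfolding abc pq by (simp add: algebra_simps)
    also have "m*x*y = c" unfolding abc pq by simp
    finally show ?thesis .
  next
    case True
    then have q: "0 < q" using zero_le_power2[of p] by linarith
    define d where "d = sqrt (4 * q - p\<^sup>2)"
    \<comment> \<open>The modulus follows from (p^2 + d^2)/4 = q. Conjugation preserves real part
      and modulus, so the pair yields one condition.\<close>
    define w where "w = Complex (- p / 2) (d / 2)"
    have d: "d\<^sup>2 = 4 * q - p\<^sup>2" using True unfolding d_def by simp
    have "z\<^sup>2 + of_real p * z + of_real q = (z - w) * (z - cnj w)" for z
      using d unfolding w_def
      by (simp add: complex_eq_iff power2_eq_square field_simps)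
    then have "poly [:of_real c, of_real b, of_real a, 1:] z = 0 \<longleftrightarrow>
        z = - of_real m \<or> z = w \<or> z = cnj w" for z :: complex
      unfolding split by (simp add: eq_neg_iff_add_eq_0)
    moreover have "cmod w = sqrt q"
      using d unfolding w_def cmod_def by (simp add: power_divide field_simps)
    moreover have "Re w = - p / 2" unfolding w_def by simp
    ultimately have "(\<forall>z. poly [:of_real c, of_real b, of_real a, 1:] z = 0 \<longrightarrow> Re z < t * cmod z) \<longleftrightarrow>
        0 < m \<and> - p / 2 < t * sqrt q"
      using t by (auto simp: real_root_in_sector_iff)
    also have "\<dots> \<longleftrightarrow> rotation_conditions (t\<^sup>2) a b c"
      unfolding abc rotation_conditions_complex_roots[OF s True]
      using complex_root_in_sector_iff[OF t(2) q] by simp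
    finally show ?thesis .
  qed
qed

theorem corollary2:
  fixes \<alpha> a\<^sub>1 a\<^sub>2 a\<^sub>3 s :: real and A :: "real mat"
  assumes alpha: "1 \<le> \<alpha>" "\<alpha> < 2"
    and A: "A \<in> carrier_mat 3 3"
    and charpoly: "char_poly A = [:a\<^sub>3, a\<^sub>2, a\<^sub>1, 1:]"
    and s: "s = (cos (\<alpha> * pi / 2))\<^sup>2"
  shows "fractional_asymptotically_stable \<alpha> A \<longleftrightarrow>
    a\<^sub>1 > 0 \<and>
    (4 * a\<^sub>1 * a\<^sub>3 - 4 * a\<^sub>2 ^ 2) * s + a\<^sub>1 ^ 2 * a\<^sub>2 - a\<^sub>1 * a\<^sub>3 > 0 \<and>
    - a\<^sub>3 * (64 * a\<^sub>3 ^ 2 * s ^ 3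
            - (16 * a\<^sub>1 * a\<^sub>2 * a\<^sub>3 + 48 * a\<^sub>3 ^ 2) * s ^ 2
            + (4 * a\<^sub>1 ^ 3 * a\<^sub>3 - 4 * a\<^sub>1 * a\<^sub>2 * a\<^sub>3 + 4 * a\<^sub>2 ^ 3 + 12 * a\<^sub>3 ^ 2) * s
            - a\<^sub>1 ^ 2 * a\<^sub>2 ^ 2 + 2 * a\<^sub>1 * a\<^sub>2 * a\<^sub>3 - a\<^sub>3 ^ 2) > 0"
proof -
  define \<theta> where "\<theta> = \<alpha> * pi / 2"
  \<comment> \<open>\<alpha> < 2 gives cos \<theta> > -1 and thus s < 1; \<alpha> \<ge> 1 gives cos
    \<theta> \<le> 0, which fixes the sign that is lost in passing to its square
    \<open>s\<close>.\<close>
  have theta: "pi / 2 \<le> \<theta>" "\<theta> < pi" using alpha unfolding \<theta>_def by auto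
  have "cos pi < cos \<theta>" using theta pi_gt_zero by (intro cos_monotone_0_pi) auto
  moreover have "cos \<theta> \<le> cos (pi / 2)" using theta by (intro cos_monotone_0_pi_le) auto
  ultimately have t: "- 1 < cos \<theta>" "cos \<theta> \<le> 0" by simp_all
  have "char_poly (map_mat complex_of_real A) = map_poly complex_of_real (char_poly A)"
    by (rule of_real_hom.char_poly_hom[OF A])
  then have "eigenvalue (map_mat complex_of_real A) z \<longleftrightarrow>
      poly [:of_real a\<^sub>3, of_real a\<^sub>2, of_real a\<^sub>1, 1:] z = 0" for z
    using A charpoly by (simp add: eigenvalue_root_char_poly[of _ 3])
  then have "fractional_asymptotically_stable \<alpha> A \<longleftrightarrow> rotation_conditions s a\<^sub>1 a\<^sub>2 a\<^sub>3"
    unfolding fractional_asymptotically_stable_def s \<theta>_def[symmetric]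
      cubic_roots_in_sector_iff[OF t, symmetric]
    using Arg_gt_iff[of \<theta>] theta pi_gt_zero by simp
  then show ?thesis
    by (simp only: rotation_conditions_def rotation_form_def rotation_resultant_def
        mult_minus_left mult_minus_right)
qed

end
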